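(* For each integer $N\ge 2$ define real numbers $R_N(N),R_N(N-1),\dots,R_N(1)$ by backward recursion: $$R_N(N)=\frac{N+1}{2},$$ and for $r=N-1,N-2,\dots,1$, $$s_r=\Big\lfloor \frac{r+1}{N+1}\,R_N(r+1)\Big\rfloor,\qquad R_N(r)=\Big(\frac{s_r}{r}\Big)^2\cdot\frac{N+1}{r+1}\cdot\frac{s_r+1}{2}+\Big(1-\Big(\frac{s_r}{r}\Big)^2\Big)R_N(r+1).$$ Then $$\lim_{N\to\infty}\frac{R_N(1)}{\sqrt N}=1.$$
   Context: Interpretation (not needed for the formal statement): in the noncooperative two-sided secretary game, each player dates at most $N$ partners, one per round, and in round $N$ must marry. The rank of each new date relative to the partners already seen is uniform on $\{1,\dots,r\}$ in round $r$, independently for the two sides. A player in round $r$ proposes iff the observed rank of the current date is at most the threshold $s_r$ (subgame perfect equilibrium threshold), and marriage occurs iff both propose. $R_N(r)$ is the expected rank (among the $N$ partners that would be seen in a full game) of the eventual mate for a player entering round $r$ under this equilibrium. The theorem concerns $R_N(1)$, the expected such rank on entering the game. *)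

theory Defs
  imports Complex_Main
begin

(* Backward recursion on r = N, N - 1, ..., 1.  Only 1 \<le> r \<le> N is meaningful: the value at r > N
   is a dummy, and at r = 0 there are divisions by zero; neither enters the values at 1 \<le> r \<le> N. *)
function expected_rank :: "nat \<Rightarrow> nat \<Rightarrow> real" where
  "expected_rank N r =
    (if r < N then
       let R' = expected_rank N (r + 1);
           s = real_of_int \<lfloor>(real r + 1) / (real N + 1) * R'\<rfloor>
       in (s / real r)\<^sup>2 * ((real N + 1) / (real r + 1)) * ((s + 1) / 2)
          + (1 - (s / real r)\<^sup>2) * R'
     else (real N + 1) / 2)"
  by auto
termination
  by (relation "Wellfounded.measure (\<lambda>(N, r). N - r)") auto

declare expected_rank.simps [simp del]

definition threshold :: "nat \<Rightarrow> nat \<Rightarrow> int" where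
  "threshold N r = \<lfloor>(real r + 1) / (real N + 1) * expected_rank N (r + 1)\<rfloor>"

lemma expected_rank_last: "expected_rank N N = (real N + 1) / 2"
  by (subst expected_rank.simps) simp

lemma expected_rank_step:
  assumes "r < N"
  shows "expected_rank N r =
    (real_of_int (threshold N r) / real r)\<^sup>2 * ((real N + 1) / (real r + 1))
        * ((real_of_int (threshold N r) + 1) / 2)
      + (1 - (real_of_int (threshold N r) / real r)\<^sup>2) * expected_rank N (r + 1)"
  using assms by (subst expected_rank.simps) (simp add: threshold_def Let_def)

end

(* Put w(r) = (N + 1) / R(r) and let q be the relative drop of R in round r, so that
   w(r) = w(r + 1) / (1 - q).  If x = (r + 1) / w(r + 1) is the quantity rounded down to the
   threshold s, then 2 q w(r + 1)^2 = ((r + 1) / r)^2 t^2 (2 - t - 1 / x) with t = s / x close to 1,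
   so w(r)^2 grows by about 1 per round, and w(1)^2 is about N.

   The rounding error 3 / x = 3 w(r + 1) / (r + 1) sums to at most 3 w(1) ln N.  The second order
   error is a multiple of the sum of q, which telescopes because w(r) - w(r + 1) \<ge> 2 q.  Both are
   negligible because w(1) is of order sqrt N. *)
theory Submission
  imports Defs "HOL-Real_Asymp.Real_Asymp"
begin

section \<open>Relative drop of the expected rank in one round\<close>

text \<open>The square is the probability that both sides propose. The quotient compares the mean
  rank of a mate accepted in round r with the value of going on. Once R(r + 1) is factored out of
  the recursion, N enters only through x.\<close>

definition rank_drop :: "nat \<Rightarrow> real \<Rightarrow> real" where
  "rank_drop r x =
    (real_of_int \<lfloor>x\<rfloor> / real r)\<^sup>2 * (1 - (real_of_int \<lfloor>x\<rfloor> + 1) / (2 * x))"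

lemma expected_rank_rank_drop:
  assumes "r < N" and "expected_rank N (r + 1) > 0"
  shows "expected_rank N r = expected_rank N (r + 1) *
    (1 - rank_drop r ((real r + 1) / (real N + 1) * expected_rank N (r + 1)))"
proof -
  define R where "R = expected_rank N (r + 1)"
  define x where "x = (real r + 1) / (real N + 1) * R"
  define s where "s = real_of_int \<lfloor>x\<rfloor>"
  have "R > 0" using assms by (simp add: R_def)
  have R: "(real N + 1) / (real r + 1) * ((s + 1) / 2) = R * ((s + 1) / (2 * x))"
  proof -
    have "a / b * ((s + 1) / 2) = R * ((s + 1) / (2 * (b / a * R)))" if "a > 0" "b > 0" for a b :: real
      using that \<open>R > 0\<close> by (simp add: field_simps)
    from this[of "real N + 1" "real r + 1"] show ?thesis unfolding x_def by linarith
  qed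
  have "expected_rank N r =
      (s / real r)\<^sup>2 * ((real N + 1) / (real r + 1) * ((s + 1) / 2)) + (1 - (s / real r)\<^sup>2) * R"
    using expected_rank_step[OF assms(1)] by (simp add: threshold_def R_def x_def s_def mult.assoc)
  also have "\<dots> = R * (1 - (s / real r)\<^sup>2 * (1 - (s + 1) / (2 * x)))"
    unfolding R by (simp add: algebra_simps)
  finally show ?thesis by (simp add: R_def x_def s_def rank_drop_def)
qed

text \<open>A threshold s = 0 makes the square vanish; for s >= 1, s + 1 <= 2 s <= 2 x.\<close>

lemma rank_drop_nonneg:
  assumes "x > 0"
  shows "rank_drop r x \<ge> 0"
proof (cases "\<lfloor>x\<rfloor> = 0")
  case False
  with assms have "1 \<le> \<lfloor>x\<rfloor>" by linarith
  then have "real_of_int \<lfloor>x\<rfloor> + 1 \<le> 2 * x" by linarith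
  with assms show ?thesis by (simp add: rank_drop_def)
qed (simp add: rank_drop_def)

text \<open>Round 1 is treated apart because there ((r + 1) / r)^2 = 4 is too large for the later
  bounds.\<close>

lemma rank_drop_first_round:
  assumes "0 < x" "x \<le> 1"
  shows "rank_drop 1 x = 0"
proof (cases "x = 1")
  case False
  with assms have "\<lfloor>x\<rfloor> = 0" by linarith
  then show ?thesis by (simp add: rank_drop_def)
qed (simp add: rank_drop_def)

section \<open>Bounds for the scaled drop\<close>

lemma rank_drop_scaled:
  assumes "r \<ge> 1" "v > 0" and x: "x = (real r + 1) / v"
  shows "2 * rank_drop r x * v\<^sup>2 = ((real r + 1) / real r)\<^sup>2 *
    ((real_of_int \<lfloor>x\<rfloor> / x)\<^sup>2 * (2 - real_of_int \<lfloor>x\<rfloor> / x - 1 / x))"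
proof -
  define s where "s = real_of_int \<lfloor>x\<rfloor>"
  have "x > 0" using assms by simp
  have v: "v = (real r + 1) / x" using assms by simp
  show ?thesis
    unfolding rank_drop_def s_def[symmetric] v using \<open>x > 0\<close> \<open>r \<ge> 1\<close>
    by (simp add: field_simps power2_eq_square)
qed

text \<open>Rounding down loses less than 1, so t >= 1 - e with e = 1 / x. Then t^2 costs 2 e and
  the factor 2 - t - e costs another e, while ((r + 1) / r)^2 is at least 1.\<close>

lemma rank_drop_scaled_lower:
  assumes "r \<ge> 1" "v > 0" and x: "x = (real r + 1) / v"
  shows "1 - 3 * v / (real r + 1) \<le> 2 * rank_drop r x * v\<^sup>2"
proof -
  define t where "t = real_of_int \<lfloor>x\<rfloor> / x"
  define e where "e = 1 / x"
  have "x > 0" using assms by simp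
  then have "0 \<le> t" "t \<le> 1" "e > 0" by (simp_all add: t_def e_def)
  have "x - 1 \<le> real_of_int \<lfloor>x\<rfloor>" by linarith
  then have "(x - 1) / x \<le> t" unfolding t_def using \<open>x > 0\<close> by (intro divide_right_mono) auto
  then have "1 - e \<le> t" using \<open>x > 0\<close> by (simp add: e_def diff_divide_distrib)
  have e: "3 * v / (real r + 1) = 3 * e" by (simp add: e_def x)
  show ?thesis
  \<comment> \<open>For 3 e >= 1 the lower bound is at most 0 and the sign of the drop suffices.
    Otherwise 1 - e is positive, so 1 - e <= t may be squared.\<close>
  proof (cases "3 * e \<ge> 1")
    case True
    then show ?thesis
      using rank_drop_nonneg[OF \<open>x > 0\<close>, of r] by (simp only: e) (smt (verit) mult_nonneg_nonneg zero_le_power2)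
  next
    case False
    have "1 - 2 * e \<le> t\<^sup>2"
    proof -
      have "(1 - e)\<^sup>2 \<le> t\<^sup>2" using False \<open>1 - e \<le> t\<close> by (intro power_mono) auto
      then show ?thesis by (simp add: power2_eq_square algebra_simps) (smt (verit) zero_le_square)
    qed
    moreover have "1 - e \<le> 2 - t - e" using \<open>t \<le> 1\<close> by simp
    ultimately have "(1 - 2 * e) * (1 - e) \<le> t\<^sup>2 * (2 - t - e)"
      using False \<open>e > 0\<close> by (intro mult_mono) auto
    moreover have "1 - 3 * e \<le> (1 - 2 * e) * (1 - e)"
      using \<open>e > 0\<close> by (simp add: algebra_simps)
    ultimately have "1 - 3 * e \<le> t\<^sup>2 * (2 - t - e)" by simp
    moreover from this have "0 \<le> t\<^sup>2 * (2 - t - e)" using False by simp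
    moreover have "1 \<le> ((real r + 1) / real r)\<^sup>2"
      using \<open>r \<ge> 1\<close> by (intro one_le_power) simp
    ultimately have "1 - 3 * e \<le> ((real r + 1) / real r)\<^sup>2 * (t\<^sup>2 * (2 - t - e))"
      using mult_right_mono[of 1 "((real r + 1) / real r)\<^sup>2" "t\<^sup>2 * (2 - t - e)"] by linarith
    then show ?thesis
      unfolding rank_drop_scaled[OF assms] e by (simp add: t_def e_def)
  qed
qed

lemma rank_drop_scaled_upper:
  assumes "r \<ge> 1" "v > 0" and x: "x = (real r + 1) / v"
  shows "2 * rank_drop r x * v\<^sup>2 \<le> ((real r + 1) / real r)\<^sup>2"
proof -
  define t where "t = real_of_int \<lfloor>x\<rfloor> / x"
  define e where "e = 1 / x"
  have "x > 0" using assms by simp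
  then have t: "0 \<le> t" "t \<le> 1" "e > 0" by (simp_all add: t_def e_def)
  have "t * (2 - t) \<le> 1" using zero_le_power2[of "1 - t"] by (simp add: power2_eq_square algebra_simps)
  then have "t * (t * (2 - t)) \<le> 1 * 1" using t by (intro mult_mono) auto
  moreover have "t\<^sup>2 * (2 - t - e) \<le> t\<^sup>2 * (2 - t)" using t by (intro mult_left_mono) auto
  ultimately have "t\<^sup>2 * (2 - t - e) \<le> 1" by (simp add: power2_eq_square mult.assoc)
  then have "((real r + 1) / real r)\<^sup>2 * (t\<^sup>2 * (2 - t - e)) \<le> ((real r + 1) / real r)\<^sup>2 * 1"
    by (intro mult_left_mono) auto
  then show ?thesis unfolding rank_drop_scaled[OF assms] by (simp add: t_def e_def)
qed

text \<open>For r = 1, v >= 2 forces x <= 1, so the drop is 0. For r >= 2, (r + 1) / r <= 3/2 gives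
  9/4, and v^2 >= 4 then gives a drop of at most 9/32 < 1/3.\<close>

lemma
  assumes "r \<ge> 1" "v \<ge> 2" and x: "x = (real r + 1) / v"
  shows rank_drop_le: "rank_drop r x \<le> 1 / 3"
    and rank_drop_scaled_le: "2 * rank_drop r x * v\<^sup>2 \<le> 9 / 4"
    and rank_drop_scaled_le_harmonic: "2 * rank_drop r x * v\<^sup>2 \<le> 1 + 4 / (real r + 1)"
proof -
  define q where "q = rank_drop r x"
  have "x > 0" using assms by simp
  have "q \<le> 1 / 3 \<and> 2 * q * v\<^sup>2 \<le> 9 / 4 \<and> 2 * q * v\<^sup>2 \<le> 1 + 4 / (real r + 1)"
  proof (cases "r = 1")
    case True
    then have "x \<le> 1" using assms by (simp add: x)
    then have "q = 0" using True rank_drop_first_round \<open>x > 0\<close> by (simp add: q_def)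
    then show ?thesis by simp
  next
    case False
    then have r: "real r \<ge> 2" using \<open>r \<ge> 1\<close> by linarith
    have up: "2 * q * v\<^sup>2 \<le> ((real r + 1) / real r)\<^sup>2"
      using rank_drop_scaled_upper[of r v x] assms by (simp add: q_def)
    have "(real r + 1) / real r \<le> 3 / 2" using r by (simp add: field_simps)
    then have "((real r + 1) / real r)\<^sup>2 \<le> (3 / 2)\<^sup>2" by (intro power_mono) auto
    also have "(3 / 2 :: real)\<^sup>2 = 9 / 4" by (simp add: power2_eq_square)
    finally have 1: "2 * q * v\<^sup>2 \<le> 9 / 4" using up by linarith
    have "2\<^sup>2 \<le> v\<^sup>2" using assms by (intro power_mono) auto
    then have "2 * q * 4 \<le> 2 * q * v\<^sup>2"
      using rank_drop_nonneg[OF \<open>x > 0\<close>] by (intro mult_left_mono) (auto simp: q_def)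
    with 1 have 2: "q \<le> 1 / 3" by simp
    \<comment> \<open>This is ((r + 1) / r)^2 <= 1 + 4 / (r + 1) with denominators cleared. It fails
      at r = 1; at r = 2 the constant 4 could be lowered only to 15/4.\<close>
    have "(real r + 1)^2 * (real r + 1) \<le> (real r + 5) * (real r)\<^sup>2"
    proof -
      have "2 * real r \<le> real r * real r" using r by (intro mult_right_mono) auto
      moreover have "(real r + 5) * (real r)\<^sup>2 - (real r + 1)^2 * (real r + 1)
          = 2 * (real r * real r) - 3 * real r - 1"
        by (simp add: power2_eq_square algebra_simps)
      ultimately show ?thesis using r by linarith
    qed
    then have "((real r + 1) / real r)\<^sup>2 \<le> 1 + 4 / (real r + 1)"
      using r by (simp add: power_divide field_simps)
    with up 1 2 show ?thesis by simp
  qed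
  then show "rank_drop r x \<le> 1 / 3" "2 * rank_drop r x * v\<^sup>2 \<le> 9 / 4"
    "2 * rank_drop r x * v\<^sup>2 \<le> 1 + 4 / (real r + 1)" by (simp_all add: q_def)
qed

section \<open>One round in terms of the inverse rank\<close>

definition inverse_rank :: "nat \<Rightarrow> nat \<Rightarrow> real" where
  "inverse_rank N r = (real N + 1) / expected_rank N r"

lemma inverse_rank_last: "inverse_rank N N = 2"
proof -
  have "real N + 1 \<noteq> 0" by linarith
  then show ?thesis by (simp add: inverse_rank_def expected_rank_last field_simps)
qed

lemma inverse_rank_step:
  assumes "r < N" and "inverse_rank N (r + 1) > 0"
  shows "inverse_rank N r =
    inverse_rank N (r + 1) / (1 - rank_drop r ((real r + 1) / inverse_rank N (r + 1)))"
proof -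
  have "expected_rank N (r + 1) > 0"
    using assms(2) by (simp add: inverse_rank_def zero_less_divide_iff)
  from expected_rank_rank_drop[OF assms(1) this] show ?thesis
    by (simp add: inverse_rank_def)
qed

text \<open>Going down from the value 2 at r = N, each round divides by 1 - q with 0 <= q <= 1/3.
  The bound itself supplies the hypothesis v >= 2 under which q <= 1/3 was shown.\<close>

lemma inverse_rank_ge_2:
  assumes "r \<le> N" "1 \<le> r"
  shows "inverse_rank N r \<ge> 2"
  using assms
proof (induction r rule: inc_induct)
  case base
  show ?case by (simp add: inverse_rank_last)
next
  case (step r)
  define v where "v = inverse_rank N (r + 1)"
  define q where "q = rank_drop r ((real r + 1) / v)"
  have v: "v \<ge> 2" using step by (simp add: v_def)
  have q: "0 \<le> q" "q \<le> 1 / 3"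
    using v step.prems rank_drop_le[of r v] by (simp_all add: q_def rank_drop_nonneg)
  have "inverse_rank N r = v / (1 - q)"
    using inverse_rank_step[of r N] step.hyps v by (simp add: v_def q_def)
  moreover have "v \<le> v / (1 - q)" using v q by (simp add: field_simps)
  ultimately show ?case using v by simp
qed

text \<open>Makes the harmonic error terms telescope.\<close>

lemma one_div_le_ln_diff:
  assumes "r \<ge> 1"
  shows "1 / (real r + 1) \<le> ln (real r + 1) - ln (real r)"
proof -
  have "ln (real r / (real r + 1)) \<le> real r / (real r + 1) - 1"
    using assms by (intro ln_le_minus_one) simp
  also have "\<dots> = - (1 / (real r + 1))" by (simp add: field_simps)
  finally show ?thesis using assms by (simp add: ln_div)
qed

text \<open>With w = v / (1 - q), squaring 1 / (1 - q) >= 1 + q gives the lower bound. For the upper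
  bound, 1 / (1 - q)^2 <= 1 + 2 q + 8 q^2 leaves the excess 8 q^2 v^2 <= 9 q, and 2 q <= v q <= w -
  v turns this into 9/2 (w - v).\<close>

lemma
  assumes "r < N" "1 \<le> r"
  shows inverse_rank_mono: "inverse_rank N (r + 1) \<le> inverse_rank N r"
    and inverse_rank_sq_step_lower:
      "(inverse_rank N (r + 1))\<^sup>2 + 1 - 3 * inverse_rank N (r + 1) / (real r + 1)
        \<le> (inverse_rank N r)\<^sup>2"
    and inverse_rank_sq_step_upper:
      "(inverse_rank N r)\<^sup>2 \<le> (inverse_rank N (r + 1))\<^sup>2 + 1 + 4 / (real r + 1)
        + 9 / 2 * (inverse_rank N r - inverse_rank N (r + 1))"
proof -
  define v where "v = inverse_rank N (r + 1)"
  define w where "w = inverse_rank N r"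
  define q where "q = rank_drop r ((real r + 1) / v)"
  have v: "v \<ge> 2" using inverse_rank_ge_2[of "r + 1" N] assms by (simp add: v_def)
  have q: "0 \<le> q" "q \<le> 1 / 3"
    using v assms rank_drop_le[of r v] by (simp_all add: q_def rank_drop_nonneg)
  have qv: "1 - 3 * v / (real r + 1) \<le> 2 * q * v\<^sup>2" "2 * q * v\<^sup>2 \<le> 9 / 4"
      "2 * q * v\<^sup>2 \<le> 1 + 4 / (real r + 1)"
    using v assms rank_drop_scaled_lower[of r v] rank_drop_scaled_le[of r v]
      rank_drop_scaled_le_harmonic[of r v] by (simp_all add: q_def)
  have w: "w = v / (1 - q)"
    using inverse_rank_step[of r N] assms v by (simp add: v_def w_def q_def)
  have "1 + q \<le> 1 / (1 - q)"
    using q by (simp add: field_simps power2_eq_square)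
  then have w_ge: "v * (1 + q) \<le> w"
    using v mult_left_mono[of "1 + q" "1 / (1 - q)" v] by (simp add: w)
  then show "inverse_rank N (r + 1) \<le> inverse_rank N r"
    using v q unfolding v_def[symmetric] w_def[symmetric] by (smt (verit) mult_le_cancel_left1)
  have "(v * (1 + q))\<^sup>2 \<le> w\<^sup>2" using w_ge v q by (intro power_mono) auto
  moreover have "(v * (1 + q))\<^sup>2 = v\<^sup>2 + 2 * q * v\<^sup>2 + (v * q)\<^sup>2"
    by (simp add: power2_eq_square algebra_simps)
  ultimately have "v\<^sup>2 + 2 * q * v\<^sup>2 \<le> w\<^sup>2" using zero_le_power2[of "v * q"] by linarith
  with qv show "(inverse_rank N (r + 1))\<^sup>2 + 1 - 3 * inverse_rank N (r + 1) / (real r + 1)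
      \<le> (inverse_rank N r)\<^sup>2"
    unfolding v_def[symmetric] w_def[symmetric] by linarith
  have "2 * q \<le> v * q" using v q by (intro mult_right_mono) auto
  then have q2: "2 * q \<le> w - v" using w_ge by (simp add: algebra_simps)
  \<comment> \<open>Here q <= 1/3 is used: it makes 5 - 14 q positive.\<close>
  have "1 \<le> (1 + 2 * q * (1 + 4 * q)) * (1 - q)\<^sup>2"
  proof -
    have "(1 + 2 * q * (1 + 4 * q)) * (1 - q)\<^sup>2 - 1 = q\<^sup>2 * (5 - 14 * q + 8 * q\<^sup>2)"
      by (simp add: power2_eq_square algebra_simps)
    moreover have "0 \<le> q\<^sup>2 * (5 - 14 * q + 8 * q\<^sup>2)"
      using q by (intro mult_nonneg_nonneg) (auto intro: add_nonneg_nonneg)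
    ultimately show ?thesis by linarith
  qed
  then have "1 / (1 - q)\<^sup>2 \<le> 1 + 2 * q * (1 + 4 * q)"
    using q by (simp add: divide_le_eq)
  then have "v\<^sup>2 * (1 / (1 - q)\<^sup>2) \<le> v\<^sup>2 * (1 + 2 * q * (1 + 4 * q))"
    by (intro mult_left_mono) auto
  then have "w\<^sup>2 \<le> v\<^sup>2 + 2 * q * v\<^sup>2 + 4 * q * (2 * q * v\<^sup>2)"
    by (simp add: w power_divide algebra_simps)
  moreover have "4 * q * (2 * q * v\<^sup>2) \<le> 9 * q"
    using q qv mult_left_mono[of "2 * q * v\<^sup>2" "9 / 4" "4 * q"] by simp
  ultimately have "w\<^sup>2 \<le> v\<^sup>2 + 2 * q * v\<^sup>2 + 9 * q" by linarith
  then show "(inverse_rank N r)\<^sup>2 \<le> (inverse_rank N (r + 1))\<^sup>2 + 1 + 4 / (real r + 1)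
        + 9 / 2 * (inverse_rank N r - inverse_rank N (r + 1))"
    using q2 qv(3) unfolding v_def[symmetric] w_def[symmetric] by argo
qed

section \<open>Summation over the rounds\<close>

lemma inverse_rank_le_first:
  assumes "r \<le> N" "1 \<le> r"
  shows "inverse_rank N r \<le> inverse_rank N 1"
  using assms(2,1)
proof (induction r rule: dec_induct)
  case (step r)
  then show ?case using inverse_rank_mono[of r N] by simp
qed simp

lemma inverse_rank_first_lower:
  assumes "1 \<le> N"
  shows "real N \<le> (inverse_rank N 1)\<^sup>2 + 3 * inverse_rank N 1 * ln (real N)"
proof -
  define W where "W = inverse_rank N 1"
  have W: "W \<ge> 2" using inverse_rank_ge_2[of 1 N] assms by (simp add: W_def)
  \<comment> \<open>The left side does not increase with r, once w(r + 1) in the error term is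
    bounded by \<open>W\<close>. Equality holds at r = 1, and r = N gives the lemma since w(N) =
    2.\<close>
  have "(inverse_rank N r)\<^sup>2 + real r - 3 * W * ln (real r) \<le> W\<^sup>2 + 1" if "r \<le> N" "1 \<le> r" for r
    using that(2,1)
  proof (induction r rule: dec_induct)
    case base
    show ?case by (simp add: W_def)
  next
    case (step r)
    have "3 * inverse_rank N (r + 1) / (real r + 1) \<le> 3 * W * (1 / (real r + 1))"
      using inverse_rank_le_first[of "r + 1" N] step by (simp add: W_def divide_right_mono)
    also have "\<dots> \<le> 3 * W * (ln (real r + 1) - ln (real r))"
      using W step one_div_le_ln_diff[of r] by (intro mult_left_mono) auto
    finally show ?case
      using inverse_rank_sq_step_lower[of r N] step by (simp add: algebra_simps)
  qed
  from this[of N] assms show ?thesis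
    by (simp add: W_def inverse_rank_last)
qed

lemma inverse_rank_first_upper:
  assumes "1 \<le> N"
  shows "(inverse_rank N 1)\<^sup>2 \<le> real N + 9 / 2 * inverse_rank N 1 + 4 * ln (real N)"
proof -
  define W where "W = inverse_rank N 1"
  \<comment> \<open>The right side does not decrease with r and equals the left side at r = 1. At r
    = N its constant terms are 4 - 9 = -5, less than the 1 on the left.\<close>
  have "W\<^sup>2 + 1 - 9 / 2 * W
      \<le> (inverse_rank N r)\<^sup>2 + real r - 9 / 2 * inverse_rank N r + 4 * ln (real r)"
    if "r \<le> N" "1 \<le> r" for r
    using that(2,1)
  proof (induction r rule: dec_induct)
    case base
    show ?case by (simp add: W_def)
  next
    case (step r)
    have "4 / (real r + 1) \<le> 4 * (ln (real r + 1) - ln (real r))"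
      using mult_left_mono[OF one_div_le_ln_diff[of r], of 4] step by simp
    moreover have "(inverse_rank N r)\<^sup>2 \<le> (inverse_rank N (r + 1))\<^sup>2 + 1 + 4 / (real r + 1)
        + 9 / 2 * (inverse_rank N r - inverse_rank N (r + 1))"
      using inverse_rank_sq_step_upper[of r N] step by simp
    moreover have "W\<^sup>2 + 1 - 9 / 2 * W
        \<le> (inverse_rank N r)\<^sup>2 + real r - 9 / 2 * inverse_rank N r + 4 * ln (real r)"
      using step by simp
    ultimately have "W\<^sup>2 + 1 - 9 / 2 * W \<le> (inverse_rank N (r + 1))\<^sup>2 + (real r + 1)
        - 9 / 2 * inverse_rank N (r + 1) + 4 * ln (real r + 1)"
      by argo
    then show ?case by (simp add: add.commute)
  qed
  from this[of N] assms show ?thesis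
    by (simp add: W_def inverse_rank_last)
qed

section \<open>Passage to the limit\<close>

text \<open>Both estimates are quadratic inequalities in w(1). Completing squares bounds w(1) on
  either side by sqrt N up to lower order, so no prior bound on its growth is required.\<close>

lemma inverse_rank_first_asymptotics:
  "(\<lambda>N. inverse_rank N 1 / sqrt (real N)) \<longlonglongrightarrow> 1"
proof (rule tendsto_sandwich)
  let ?l = "\<lambda>N. (sqrt (real N) - 3 * ln (real N)) / sqrt (real N)"
  let ?u = "\<lambda>N. (9 / 2 + sqrt (real N + 4 * ln (real N))) / sqrt (real N)"
  show "\<forall>\<^sub>F N in sequentially. ?l N \<le> inverse_rank N 1 / sqrt (real N)"
    using eventually_ge_at_top[of 1]
  proof eventually_elim
    case (elim N)
    define W where "W = inverse_rank N 1"
    have W: "W \<ge> 2" using inverse_rank_ge_2[of 1 N] elim by (simp add: W_def)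
    have "ln (real N) \<ge> 0" using elim by simp
    have "real N \<le> W\<^sup>2 + 3 * W * ln (real N)"
      using inverse_rank_first_lower[OF elim] by (simp add: W_def)
    also have "\<dots> \<le> (W + 3 * ln (real N))\<^sup>2"
      using W \<open>ln (real N) \<ge> 0\<close> by (simp add: power2_eq_square algebra_simps)
    finally have "sqrt (real N) \<le> W + 3 * ln (real N)"
      using W \<open>ln (real N) \<ge> 0\<close> by (intro real_le_lsqrt) auto
    then show ?case by (intro divide_right_mono) (auto simp: W_def)
  qed
  show "\<forall>\<^sub>F N in sequentially. inverse_rank N 1 / sqrt (real N) \<le> ?u N"
    using eventually_ge_at_top[of 1]
  proof eventually_elim
    case (elim N)
    define W where "W = inverse_rank N 1"
    have W: "W \<ge> 2" using inverse_rank_ge_2[of 1 N] elim by (simp add: W_def)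
    have "ln (real N) \<ge> 0" using elim by simp
    have "W \<le> 9 / 2 + sqrt (real N + 4 * ln (real N))"
    proof (cases "W \<le> 9 / 2")
      case True
      then show ?thesis using \<open>ln (real N) \<ge> 0\<close> by (simp add: add_increasing2)
    next
      case False
      \<comment> \<open>The two sides differ by 9/2 (W - 9/2), which is positive in this
        case.\<close>
      then have "(W - 9 / 2)\<^sup>2 \<le> W\<^sup>2 - 9 / 2 * W"
        by (simp add: power2_eq_square algebra_simps)
      also have "\<dots> \<le> real N + 4 * ln (real N)"
        using inverse_rank_first_upper[OF elim] by (simp add: W_def)
      finally have "W - 9 / 2 \<le> sqrt (real N + 4 * ln (real N))"
        by (rule real_le_rsqrt)
      then show ?thesis by simp
    qed
    then show ?case by (intro divide_right_mono) (auto simp: W_def)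
  qed
  show "?l \<longlonglongrightarrow> 1" by real_asymp
  show "?u \<longlonglongrightarrow> 1" by real_asymp
qed

theorem theorem1:
  shows "(\<lambda>N. expected_rank N 1 / sqrt (real N)) \<longlonglongrightarrow> 1"
proof -
  have "(\<lambda>N. ((real N + 1) / real N) / (inverse_rank N 1 / sqrt (real N))) \<longlonglongrightarrow> 1 / 1"
    by (intro tendsto_divide inverse_rank_first_asymptotics) (real_asymp | simp)+
  moreover have "\<forall>\<^sub>F N in sequentially.
      ((real N + 1) / real N) / (inverse_rank N 1 / sqrt (real N)) = expected_rank N 1 / sqrt (real N)"
    using eventually_ge_at_top[of 1]
  proof eventually_elim
    case (elim N)
    define S where "S = sqrt (real N)"
    have "S > 0" and N: "real N = S * S" using elim by (simp_all add: S_def)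
    have "(real N + 1) / inverse_rank N 1 = expected_rank N 1"
      by (simp add: inverse_rank_def add_eq_0_iff)
    moreover have "(a / (S * S)) / (w / S) = (a / w) / S" for a w
      using \<open>S > 0\<close> by simp
    ultimately have "((real N + 1) / (S * S)) / (inverse_rank N 1 / S) = expected_rank N 1 / S"
      by metis
    then show ?case unfolding S_def[symmetric] N[symmetric] .
  qed
  ultimately show ?thesis by (simp add: tendsto_cong)
qed

end
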